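(* Let $\mathbf y=(y_1,\dots,y_N)$ be the received sequence from a binary-input finite-state channel, and let $\mathcal C$ be a binary linear code of length $N$ with parity-check matrix $H$. The LP joint decoder computes $$\mathbf g\in\operatorname*{arg\,min}_{\mathbf g\in\mathcal P_{\mathcal T}(H)}\ \sum_{i=1}^N\sum_{e\in\mathcal T_i} b_{i,e}\,g_{i,e}.$$ If the resulting minimizer $\mathbf g$ is integral (all $g_{i,e}\in\{0,1\}$), then it is a joint maximum-likelihood (ML) edge-path: $\mathbf g$ is the indicator vector of a trellis path whose input/state sequence pair $(x_1^N,s_0^N)$ maximizes $$P_0(s_0)\prod_{i=1}^N P(y_i,s_i\mid x_i,s_{i-1})$$ over the set $\mathcal V$ of all valid input/state sequence pairs, i.e. pairs labelling a path through the trellis whose input sequence $x_1^N$ is a codeword of $\mathcal C$.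
   Context: Finite-state channel: finite state set $\mathcal S$, inputs $x\in\{0,1\}$, transition law $P(y,s'\mid x,s)=\Pr(Y_i=y,S_i=s'\mid X_i=x,S_{i-1}=s)$ (a density in $y$ if outputs are continuous), initial state distribution $P_0(s)=\Pr(S_0=s)$, and $P(y_1^N,s_1^N\mid x_1^N,s_0)=\prod_{i=1}^N P(y_i,s_i\mid x_i,s_{i-1})$. Trellis: one trellis section has edge set $E=\{1,\dots,O\}$, with one edge for each input-labelled state transition. An edge $e$ has initial state $s(e)$, final state $s'(e)$ and input bit $x(e)$; distinct edges have distinct triples $(s(e),x(e),s'(e))$, and $P(y,s'\mid x,s)=0$ for triples that are not edges. $\mathcal T_i$ denotes the copy of the edge set at time $i\in\{1,\dots,N\}$. Branch metrics: $b_{i,e}=-\ln P(y_i,s'(e)\mid x(e),s(e))$ for $i>1$ and $b_{1,e}=-\ln[P(y_1,s'(e)\mid x(e),s(e))\,P_0(s(e))]$, with $-\ln 0=+\infty$ and $0\cdot(+\infty)=0$. Trellis polytope $\mathcal T$: the set of $\mathbf g\in[0,1]^{N\times O}$ such that $\sum_{e:s'(e)=k}g_{i,e}=\sum_{e:s(e)=k}g_{i+1,e}$ for all $i=1,\dots,N-1$ and $k\in\mathcal S$, and $\sum_{e\in\mathcal T_p}g_{p,e}=1$ for any $p\in\{1,\dots,N\}$. Code: $\mathcal C=\{\mathbf c\in\{0,1\}^N: \sum_{i\in L}c_i\equiv 0 \bmod 2\ \forall L\in\mathcal L\}$, where $\mathcal L$ is the collection of supports of the rows of $H$. Relaxed polytope: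 $\mathcal P(H)=\bigcap_{L\in\mathcal L}\mathrm{LCP}(L)$, with $\mathrm{LCP}(L)=\bigcap_{S\subseteq L,\,|S|\text{ odd}}\{\mathbf c\in[0,1]^N:\sum_{i\in S}c_i-\sum_{i\in L\setminus S}c_i\le |S|-1\}$. Projection: $\mathcal Q(\mathbf g)=(f_1,\dots,f_N)$ with $f_i=\sum_{e\in\mathcal T_i:\,x(e)=1}g_{i,e}$. Trellis-wise relaxed polytope: $\mathcal P_{\mathcal T}(H)=\{\mathbf g\in\mathcal T:\mathcal Q(\mathbf g)\in\mathcal P(H)\}$. *)

theory Defs
  imports "HOL-Probability.Probability" "HOL-Library.Z2"
begin

text \<open>
  Vectors of length \<open>N\<close>, edge sequences and trellis-indexed vectors are functions on
  \<open>{1..N}\<close> or \<open>{1..N} \<times> {1..O}\<close>, constrained by \<^const>\<open>PiE\<close>, so that they are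
  \<^const>\<open>undefined\<close> outside their index set and equality is equality of vectors.
  The binary alphabet is the two-element field \<^typ>\<open>bit\<close>.
\<close>

section \<open>Finite-state channel\<close>

text \<open>
  \<open>P y s' x s\<close> stands for $P(y,s' \mid x,s)$. It is a density in \<open>y\<close> with respect to the
  reference measure \<open>M\<close> on the output alphabet; a discrete output alphabet \<open>Y\<close> is the
  case \<open>M = count_space Y\<close>.
\<close>

definition finite_state_channel ::
    "'y measure \<Rightarrow> ('y \<Rightarrow> 's::finite \<Rightarrow> bit \<Rightarrow> 's \<Rightarrow> real) \<Rightarrow> bool" where
  "finite_state_channel M P \<longleftrightarrow>
     (\<forall>y\<in>space M. \<forall>s' x s. 0 \<le> P y s' x s) \<and>
     (\<forall>s' x s. (\<lambda>y. P y s' x s) \<in> borel_measurable M) \<and>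
     (\<forall>x s. (\<Sum>s'\<in>UNIV. \<integral>\<^sup>+ y. ennreal (P y s' x s) \<partial>M) = 1)"

text \<open>
  The joint probability (density) of the outputs and of the state sequence, given the inputs;
  the value is $P_0(s_0) \prod_i P(y_i,s_i \mid x_i,s_{i-1})$.
\<close>

definition path_likelihood ::
    "nat \<Rightarrow> ('y \<Rightarrow> 's \<Rightarrow> bit \<Rightarrow> 's \<Rightarrow> real) \<Rightarrow> 's pmf \<Rightarrow> (nat \<Rightarrow> 'y) \<Rightarrow>
     (nat \<Rightarrow> bit) \<times> (nat \<Rightarrow> 's) \<Rightarrow> real" where
  "path_likelihood N P P0 y = (\<lambda>(x, s). pmf P0 (s 0) * (\<Prod>i=1..N. P (y i) (s i) (x i) (s (i - 1))))"

section \<open>Trellis\<close>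

record 's trellis =
  num_edges :: nat
  init :: "nat \<Rightarrow> 's"
  final :: "nat \<Rightarrow> 's"
  inp :: "nat \<Rightarrow> bit"

definition edges :: "'s trellis \<Rightarrow> nat set" where
  "edges T = {1..num_edges T}"

definition trellis_for_channel ::
    "'y measure \<Rightarrow> ('y \<Rightarrow> 's \<Rightarrow> bit \<Rightarrow> 's \<Rightarrow> real) \<Rightarrow> 's trellis \<Rightarrow> bool" where
  "trellis_for_channel M P T \<longleftrightarrow>
     inj_on (\<lambda>e. (init T e, inp T e, final T e)) (edges T) \<and>
     (\<forall>s x s'. (s, x, s') \<notin> (\<lambda>e. (init T e, inp T e, final T e)) ` edges T \<longrightarrow>
        (\<forall>y\<in>space M. P y s' x s = 0))"

text \<open>The edge sequence \<open>p\<close> is a path labelled by inputs $x_1^N$ and states $s_0^N$.\<close>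

definition labelled_path ::
    "nat \<Rightarrow> 's trellis \<Rightarrow> (nat \<Rightarrow> nat) \<Rightarrow> (nat \<Rightarrow> bit) \<Rightarrow> (nat \<Rightarrow> 's) \<Rightarrow> bool" where
  "labelled_path N T p x s \<longleftrightarrow>
     p \<in> {1..N} \<rightarrow>\<^sub>E edges T \<and> x \<in> {1..N} \<rightarrow>\<^sub>E UNIV \<and> s \<in> {0..N} \<rightarrow>\<^sub>E UNIV \<and>
     (\<forall>i\<in>{1..N}. init T (p i) = s (i - 1) \<and> inp T (p i) = x i \<and> final T (p i) = s i)"

definition path_indicator :: "nat \<Rightarrow> 's trellis \<Rightarrow> (nat \<Rightarrow> nat) \<Rightarrow> nat \<times> nat \<Rightarrow> real" where
  "path_indicator N T p = (\<lambda>(i, e)\<in>{1..N} \<times> edges T. if p i = e then 1 else 0)"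

definition trellis_polytope :: "nat \<Rightarrow> 's trellis \<Rightarrow> (nat \<times> nat \<Rightarrow> real) set" where
  "trellis_polytope N T =
     {g \<in> {1..N} \<times> edges T \<rightarrow>\<^sub>E {0..1}.
        (\<forall>i\<in>{1..<N}. \<forall>k.
           (\<Sum>e\<in>{e \<in> edges T. final T e = k}. g (i, e)) =
           (\<Sum>e\<in>{e \<in> edges T. init T e = k}. g (i + 1, e))) \<and>
        (\<forall>p\<in>{1..N}. (\<Sum>e\<in>edges T. g (p, e)) = 1)}"

text \<open>The case distinction is needed because \<open>ln 0 = 0\<close> for \<^typ>\<open>real\<close>.\<close>

definition neg_ln :: "real \<Rightarrow> ereal" where
  "neg_ln p = (if p = 0 then \<infinity> else ereal (- ln p))"

definition branch_metric ::
    "('y \<Rightarrow> 's \<Rightarrow> bit \<Rightarrow> 's \<Rightarrow> real) \<Rightarrow> 's pmf \<Rightarrow> 's trellis \<Rightarrow> (nat \<Rightarrow> 'y) \<Rightarrow> nat \<Rightarrow> nat \<Rightarrow> ereal" where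
  "branch_metric P P0 T y i e =
     (if i = 1 then neg_ln (P (y 1) (final T e) (inp T e) (init T e) * pmf P0 (init T e))
      else neg_ln (P (y i) (final T e) (inp T e) (init T e)))"

text \<open>In \<^typ>\<open>ereal\<close>, \<open>\<infinity> * 0 = 0\<close>; no summand is \<open>-\<infinity>\<close> for \<open>g\<close> in the trellis polytope.\<close>

definition LP_cost ::
    "nat \<Rightarrow> ('y \<Rightarrow> 's \<Rightarrow> bit \<Rightarrow> 's \<Rightarrow> real) \<Rightarrow> 's pmf \<Rightarrow> 's trellis \<Rightarrow> (nat \<Rightarrow> 'y) \<Rightarrow>
     (nat \<times> nat \<Rightarrow> real) \<Rightarrow> ereal" where
  "LP_cost N P P0 T y g =
     (\<Sum>i=1..N. \<Sum>e\<in>edges T. branch_metric P P0 T y i e * ereal (g (i, e)))"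

section \<open>Code and relaxed polytopes\<close>

text \<open>\<open>H j i\<close> is the entry of an \<open>m \<times> N\<close> matrix in row \<open>j \<in> {1..m}\<close>, column \<open>i \<in> {1..N}\<close>.\<close>

definition row_supports :: "nat \<Rightarrow> nat \<Rightarrow> (nat \<Rightarrow> nat \<Rightarrow> bit) \<Rightarrow> nat set set" where
  "row_supports m N H = (\<lambda>j. {i \<in> {1..N}. H j i = 1}) ` {1..m}"

definition code :: "nat \<Rightarrow> nat \<Rightarrow> (nat \<Rightarrow> nat \<Rightarrow> bit) \<Rightarrow> (nat \<Rightarrow> bit) set" where
  "code m N H = {c \<in> {1..N} \<rightarrow>\<^sub>E UNIV. \<forall>L\<in>row_supports m N H. (\<Sum>i\<in>L. c i) = 0}"

text \<open>
  The intersections are taken inside the cube $[0,1]^N$, so that an empty intersection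
  (\<open>L = {}\<close> or \<open>m = 0\<close>) is the cube.
\<close>

definition LCP :: "nat \<Rightarrow> nat set \<Rightarrow> (nat \<Rightarrow> real) set" where
  "LCP N L = {c \<in> {1..N} \<rightarrow>\<^sub>E {0..1}.
     \<forall>S. S \<subseteq> L \<and> odd (card S) \<longrightarrow> (\<Sum>i\<in>S. c i) - (\<Sum>i\<in>L - S. c i) \<le> real (card S) - 1}"

definition relaxed_polytope :: "nat \<Rightarrow> nat \<Rightarrow> (nat \<Rightarrow> nat \<Rightarrow> bit) \<Rightarrow> (nat \<Rightarrow> real) set" where
  "relaxed_polytope m N H = {c \<in> {1..N} \<rightarrow>\<^sub>E {0..1}. \<forall>L\<in>row_supports m N H. c \<in> LCP N L}"

definition projection :: "nat \<Rightarrow> 's trellis \<Rightarrow> (nat \<times> nat \<Rightarrow> real) \<Rightarrow> nat \<Rightarrow> real" where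
  "projection N T g = (\<lambda>i\<in>{1..N}. \<Sum>e\<in>{e \<in> edges T. inp T e = 1}. g (i, e))"

definition trellis_relaxed_polytope ::
    "nat \<Rightarrow> nat \<Rightarrow> (nat \<Rightarrow> nat \<Rightarrow> bit) \<Rightarrow> 's trellis \<Rightarrow> (nat \<times> nat \<Rightarrow> real) set" where
  "trellis_relaxed_polytope m N H T =
     {g \<in> trellis_polytope N T. projection N T g \<in> relaxed_polytope m N H}"

definition valid_pairs ::
    "nat \<Rightarrow> nat \<Rightarrow> (nat \<Rightarrow> nat \<Rightarrow> bit) \<Rightarrow> 's trellis \<Rightarrow> ((nat \<Rightarrow> bit) \<times> (nat \<Rightarrow> 's)) set" where
  "valid_pairs m N H T = {(x, s). (\<exists>p. labelled_path N T p x s) \<and> x \<in> code m N H}"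

end

theory Submission
  imports Defs
begin

text \<open>
  Integral points of the trellis polytope are exactly the indicator vectors of trellis paths, and a
  0/1 vector satisfies the odd-set inequalities of a check iff it satisfies the check itself. So
  the integral points of the relaxed polytope are the indicators of the paths labelled by valid
  pairs, and on them the LP cost is the negative logarithm of the path likelihood. A minimizer of
  the LP that happens to be integral therefore maximizes the likelihood among all valid pairs.
\<close>

section \<open>Codewords and the relaxed polytope\<close>

definition bit_real :: "bit \<Rightarrow> real" where
  "bit_real b = of_bool (b = 1)"

text \<open>Addition in the two-element field counts ones modulo 2. This turns a check of
  \<open>code\<close> into a parity condition, which is what the odd-set inequalities
  detect.\<close>

lemma sum_bit_eq_0_iff:
  fixes c :: "'a \<Rightarrow> bit"
  assumes "finite L"
  shows "(\<Sum>i\<in>L. c i) = 0 \<longleftrightarrow> even (card {i \<in> L. c i = 1})"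
  using assms
proof (induction L rule: finite_induct)
  case (insert a L)
  show ?case
  proof (cases "c a = 1")
    case True
    then have "{i \<in> insert a L. c i = 1} = insert a {i \<in> L. c i = 1}" by auto
    then have "card {i \<in> insert a L. c i = 1} = Suc (card {i \<in> L. c i = 1})"
      using insert by simp
    then show ?thesis
      using insert True by (cases "sum c L") auto
  next
    case False
    then have "{i \<in> insert a L. c i = 1} = {i \<in> L. c i = 1}" by auto
    then show ?thesis using insert False by (cases "c a") auto
  qed
qed simp

lemma sum_bit_real:
  assumes "finite S"
  shows "(\<Sum>i\<in>S. bit_real (c i)) = real (card {i \<in> S. c i = 1})"
proof -
  have "(\<Sum>i\<in>S. bit_real (c i)) = (\<Sum>i\<in>{i \<in> S. c i = 1}. 1)"
    unfolding bit_real_def by (rule sum.mono_neutral_cong_right) (use assms in auto)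
  then show ?thesis by simp
qed

text \<open>Let \<open>A\<close> be the set of ones of \<open>c\<close> in \<open>L\<close>. The
  left side of the inequality for \<open>S\<close> is |S| minus the size of the symmetric difference
  of \<open>S\<close> and \<open>A\<close>, so the inequality says exactly that \<open>S\<close>
  differs from \<open>A\<close>. All odd \<open>S\<close> satisfy this iff \<open>A\<close> is
  even.\<close>

lemma bit_real_in_LCP_iff:
  assumes L: "L \<subseteq> {1..N}"
  shows "(\<lambda>i\<in>{1..N}. bit_real (c i)) \<in> LCP N L \<longleftrightarrow> (\<Sum>i\<in>L. c i) = 0"
proof -
  have fin: "finite L" using L finite_subset by blast
  let ?A = "{i \<in> L. c i = 1}"
  have restr: "(\<Sum>i\<in>S. restrict (\<lambda>i. bit_real (c i)) {1..N} i) = real (card {i \<in> S. c i = 1})"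
    if "S \<subseteq> L" for S
  proof -
    have "(\<Sum>i\<in>S. restrict (\<lambda>i. bit_real (c i)) {1..N} i) = (\<Sum>i\<in>S. bit_real (c i))"
      by (rule sum.cong) (use that L in auto)
    then show ?thesis using sum_bit_real finite_subset[OF that fin] by metis
  qed
  have cube: "(\<lambda>i\<in>{1..N}. bit_real (c i)) \<in> {1..N} \<rightarrow>\<^sub>E {0..1}"
    by (auto simp: bit_real_def)
  have "(\<forall>S. S \<subseteq> L \<and> odd (card S) \<longrightarrow>
      real (card {i \<in> S. c i = 1}) - real (card {i \<in> L - S. c i = 1}) \<le> real (card S) - 1)
    \<longleftrightarrow> even (card ?A)" (is "?ineqs \<longleftrightarrow> _")
  proof
    assume ?ineqs
    show "even (card ?A)"
    proof (rule ccontr)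
      assume "odd (card ?A)"
      moreover have "?A \<subseteq> L" by auto
      ultimately have "real (card {i \<in> ?A. c i = 1}) - real (card {i \<in> L - ?A. c i = 1})
          \<le> real (card ?A) - 1"
        using \<open>?ineqs\<close> by blast
      moreover have "{i \<in> ?A. c i = 1} = ?A" "{i \<in> L - ?A. c i = 1} = {}" by auto
      ultimately show False by (simp only: card.empty)
    qed
  next
    assume even: "even (card ?A)"
    show ?ineqs
    proof (intro allI impI)
      fix S assume S: "S \<subseteq> L \<and> odd (card S)"
      then have finS: "finite S" using fin finite_subset by blast
      show "real (card {i \<in> S. c i = 1}) - real (card {i \<in> L - S. c i = 1}) \<le> real (card S) - 1"
      \<comment> \<open>If \<open>S\<close> leaves \<open>?A\<close>, the positive sum already falls
        short of \<open>card S\<close>. Otherwise \<open>S\<close> is a proper subset of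
        \<open>?A\<close>, as the parities differ, and a leftover one makes the subtracted sum at
        least 1.\<close>
      proof (cases "S \<subseteq> ?A")
        case False
        then have "{i \<in> S. c i = 1} \<subset> S" using S by auto
        then have "card {i \<in> S. c i = 1} < card S" by (rule psubset_card_mono[OF finS])
        then show ?thesis by linarith
      next
        case True
        with S even have "S \<noteq> ?A" by auto
        with True have "{i \<in> L - S. c i = 1} \<noteq> {}" by auto
        then have "card {i \<in> L - S. c i = 1} > 0" using fin by (simp add: card_gt_0_iff)
        moreover have "card {i \<in> S. c i = 1} \<le> card S" using finS by (intro card_mono) auto
        ultimately show ?thesis by linarith
      qed
    qed
  qed
  then show ?thesis
    unfolding LCP_def using cube restr sum_bit_eq_0_iff[OF fin, of c]
    by (simp cong: conj_cong imp_cong)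
qed

text \<open>The restriction hides the values of \<open>c\<close> outside \<open>{1..N}\<close>,
  whereas \<open>code\<close> requires them to be \<open>undefined\<close>; hence the assumption on
  \<open>c\<close>.\<close>

lemma bit_real_in_relaxed_polytope_iff:
  assumes "c \<in> {1..N} \<rightarrow>\<^sub>E UNIV"
  shows "(\<lambda>i\<in>{1..N}. bit_real (c i)) \<in> relaxed_polytope m N H \<longleftrightarrow> c \<in> code m N H"
proof -
  have "(\<lambda>i\<in>{1..N}. bit_real (c i)) \<in> LCP N L \<longleftrightarrow> (\<Sum>i\<in>L. c i) = 0"
    if "L \<in> row_supports m N H" for L
    using that by (intro bit_real_in_LCP_iff) (auto simp: row_supports_def)
  moreover have "(\<lambda>i\<in>{1..N}. bit_real (c i)) \<in> {1..N} \<rightarrow>\<^sub>E {0..1}"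
    by (auto simp: bit_real_def)
  ultimately show ?thesis
    using assms by (simp add: relaxed_polytope_def code_def)
qed

section \<open>Paths and the trellis polytope\<close>

lemma finite_edges [simp]: "finite (edges T)"
  by (simp add: edges_def)

text \<open>The unit mass at time \<open>i\<close> sits on the edge \<open>p i\<close>. The choices
  of \<open>Q\<close> used below give normalization, both sides of flow conservation, and the
  projection.\<close>

lemma sum_path_indicator:
  assumes "labelled_path N T p x s" "i \<in> {1..N}"
  shows "(\<Sum>e\<in>{e \<in> edges T. Q e}. path_indicator N T p (i, e)) = of_bool (Q (p i))"
proof -
  have "p i \<in> edges T" using assms by (auto simp: labelled_path_def)
  moreover have "(\<Sum>e\<in>{e \<in> edges T. Q e}. path_indicator N T p (i, e)) =
      (\<Sum>e\<in>{e \<in> edges T. Q e}. if p i = e then 1 else 0)"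
    by (rule sum.cong) (use assms in \<open>auto simp: path_indicator_def\<close>)
  ultimately show ?thesis by simp
qed

lemma path_indicator_in_trellis_polytope:
  assumes p: "labelled_path N T p x s"
  shows "path_indicator N T p \<in> trellis_polytope N T"
proof -
  have "init T (p (i + 1)) = final T (p i)" if "i \<in> {1..<N}" for i
    using p that by (auto simp: labelled_path_def)
  moreover have "path_indicator N T p \<in> {1..N} \<times> edges T \<rightarrow>\<^sub>E {0..1}"
    by (auto simp: path_indicator_def)
  moreover have "(\<Sum>e\<in>edges T. path_indicator N T p (i, e)) = 1" if "i \<in> {1..N}" for i
    using sum_path_indicator[OF p that, of "\<lambda>_. True"] by simp
  ultimately show ?thesis
    by (simp add: trellis_polytope_def sum_path_indicator[OF p])
qed

lemma projection_path_indicator: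
  assumes p: "labelled_path N T p x s"
  shows "projection N T (path_indicator N T p) = (\<lambda>i\<in>{1..N}. bit_real (x i))"
proof -
  have "inp T (p i) = x i" if "i \<in> {1..N}" for i
    using p that by (auto simp: labelled_path_def)
  then show ?thesis
    by (auto simp: projection_def bit_real_def sum_path_indicator[OF p] fun_eq_iff)
qed

text \<open>A path meets the trellis constraints by itself, so only its projection is tested, and
  that is the input word \<open>x\<close> embedded in the cube.\<close>

lemma path_indicator_in_trellis_relaxed_polytope_iff:
  assumes p: "labelled_path N T p x s"
  shows "path_indicator N T p \<in> trellis_relaxed_polytope m N H T \<longleftrightarrow> (x, s) \<in> valid_pairs m N H T"
proof -
  have "x \<in> {1..N} \<rightarrow>\<^sub>E UNIV" using p by (simp add: labelled_path_def)
  then show ?thesis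
    using p path_indicator_in_trellis_polytope[OF p] bit_real_in_relaxed_polytope_iff[of x N m H]
    by (auto simp only: trellis_relaxed_polytope_def valid_pairs_def projection_path_indicator[OF p]
        mem_Collect_eq prod.case)
qed

text \<open>The sum counts the points where \<open>f\<close> is 1, so there is exactly one.\<close>

lemma sum_0_1_eq_1_imp_indicator:
  fixes f :: "'a \<Rightarrow> real"
  assumes "finite A" "\<And>a. a \<in> A \<Longrightarrow> f a \<in> {0, 1}" "sum f A = 1"
  shows "\<exists>a\<in>A. \<forall>b\<in>A. f b = (if a = b then 1 else 0)"
proof -
  have "sum f A = (\<Sum>a\<in>{a \<in> A. f a = 1}. 1)"
    by (rule sum.mono_neutral_cong_right) (use assms in auto)
  then have "card {a \<in> A. f a = 1} = 1" using assms(3) by simp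
  then obtain a where a: "{a \<in> A. f a = 1} = {a}" by (rule card_1_singletonE)
  then show ?thesis using assms(2) by (intro bexI[of _ a]) fastforce+
qed

text \<open>The initial state is prescribed by \<open>s0\<close> because a path of length 0 does not determine it.\<close>

lemma integral_point_is_path_indicator:
  assumes g: "g \<in> trellis_polytope N T"
    and int: "\<And>i e. i \<in> {1..N} \<Longrightarrow> e \<in> edges T \<Longrightarrow> g (i, e) \<in> {0, 1}"
  obtains p x s where "labelled_path N T p x s" "g = path_indicator N T p" "N = 0 \<Longrightarrow> s 0 = s0"
proof -
  have "\<exists>a\<in>edges T. \<forall>e\<in>edges T. g (i, e) = (if a = e then 1 else 0)" if "i \<in> {1..N}" for i
    using sum_0_1_eq_1_imp_indicator[of "edges T" "\<lambda>e. g (i, e)"] int g that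
    by (auto simp: trellis_polytope_def)
  then obtain q where q: "\<And>i. i \<in> {1..N} \<Longrightarrow> q i \<in> edges T"
    "\<And>i e. i \<in> {1..N} \<Longrightarrow> e \<in> edges T \<Longrightarrow> g (i, e) = (if q i = e then 1 else 0)"
    by metis
  have flow: "init T (q (i + 1)) = final T (q i)" if i: "i \<in> {1..<N}" for i
  proof -
    \<comment> \<open>Conservation at the state reached by \<open>q i\<close>: the left sum counts
      \<open>q i\<close> and equals 1, so the right sum must count \<open>q (i + 1)\<close>.\<close>
    have "(\<Sum>e\<in>{e \<in> edges T. final T e = final T (q i)}. g (i, e)) =
        (\<Sum>e\<in>{e \<in> edges T. init T e = final T (q i)}. g (i + 1, e))"
      using g i unfolding trellis_polytope_def by blast
    moreover have "(\<Sum>e\<in>{e \<in> edges T. final T e = final T (q i)}. g (i, e)) =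
        (\<Sum>e\<in>{e \<in> edges T. final T e = final T (q i)}. if q i = e then 1 else 0)"
      by (rule sum.cong) (use q i in auto)
    moreover have "(\<Sum>e\<in>{e \<in> edges T. init T e = final T (q i)}. g (i + 1, e)) =
        (\<Sum>e\<in>{e \<in> edges T. init T e = final T (q i)}. if q (i + 1) = e then 1 else 0)"
      by (rule sum.cong) (use q i in auto)
    moreover have "q i \<in> edges T" using q i by auto
    ultimately show ?thesis by (simp split: if_splits)
  qed
  define p where "p = restrict q {1..N}"
  define x where "x = (\<lambda>i\<in>{1..N}. inp T (q i))"
  \<comment> \<open>Time 0 is the only time at which no edge ends, so its state is read off the
    start of the first edge.\<close>
  define s where "s = (\<lambda>i\<in>{0..N}. if N = 0 then s0 else if i = 0 then init T (q 1) else final T (q i))"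
  have "init T (q i) = s (i - 1)" if "i \<in> {1..N}" for i
    using flow[of "i - 1"] that by (cases "i = 1") (force simp: s_def)+
  then have "labelled_path N T p x s"
    using q(1) by (auto simp: labelled_path_def p_def x_def s_def)
  moreover have "g = path_indicator N T p"
  proof
    fix ie
    show "g ie = path_indicator N T p ie"
    proof (cases "ie \<in> {1..N} \<times> edges T")
      case True
      then show ?thesis using q by (auto simp: path_indicator_def p_def)
    next
      case False
      then have "g ie = undefined" "path_indicator N T p ie = undefined"
        using g unfolding trellis_polytope_def path_indicator_def by (blast dest: PiE_arb, simp)
      then show ?thesis by simp
    qed
  qed
  moreover have "N = 0 \<Longrightarrow> s 0 = s0" by (simp add: s_def)
  ultimately show ?thesis using that by blast
qed

section \<open>Cost and likelihood\<close>

text \<open>A zero factor makes both sides \<open>\<infinity>\<close>; as \<open>neg_ln\<close> is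
  never \<open>-\<infinity>\<close>, the sum is harmless.\<close>

lemma neg_ln_mult:
  assumes "0 \<le> a" "0 \<le> b"
  shows "neg_ln (a * b) = neg_ln a + neg_ln b"
  using assms by (auto simp: neg_ln_def ln_mult)

lemma neg_ln_prod:
  assumes "finite A" "\<And>i. i \<in> A \<Longrightarrow> 0 \<le> f i"
  shows "neg_ln (\<Prod>i\<in>A. f i) = (\<Sum>i\<in>A. neg_ln (f i))"
  using assms
proof (induction A rule: finite_induct)
  case empty
  then show ?case by (simp add: neg_ln_def zero_ereal_def)
next
  case (insert a A)
  then show ?case by (simp add: neg_ln_mult prod_nonneg)
qed

text \<open>Here \<open>b\<close> is positive, so \<open>neg_ln b\<close> is finite and stays below
  \<open>neg_ln a\<close> even for \<open>a = 0\<close>.\<close>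

lemma neg_ln_less:
  assumes "0 \<le> a" "a < b"
  shows "neg_ln b < neg_ln a"
  using assms by (auto simp: neg_ln_def)

lemma path_likelihood_nonneg:
  assumes "\<And>i s' x s. i \<in> {1..N} \<Longrightarrow> 0 \<le> P (y i) s' x s"
  shows "0 \<le> path_likelihood N P P0 y v"
  using assms by (auto simp: path_likelihood_def split_beta intro!: mult_nonneg_nonneg prod_nonneg)

text \<open>The logarithm turns the product over time into the sum of branch metrics along the path.
  The initial probability enters through the first section, so for \<open>N = 0\<close> the cost
  would miss it.\<close>

lemma LP_cost_path_indicator:
  assumes p: "labelled_path N T p x s" and "N > 0"
    and nn: "\<And>i s' x s. i \<in> {1..N} \<Longrightarrow> 0 \<le> P (y i) s' x s"
  shows "LP_cost N P P0 T y (path_indicator N T p) = neg_ln (path_likelihood N P P0 y (x, s))"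
proof -
  let ?w = "\<lambda>i. P (y i) (s i) (x i) (s (i - 1)) * (if i = 1 then pmf P0 (s 0) else 1)"
  have "(\<Sum>e\<in>edges T. branch_metric P P0 T y i e * ereal (path_indicator N T p (i, e))) = neg_ln (?w i)"
    if i: "i \<in> {1..N}" for i
  proof -
    have pi: "p i \<in> edges T" "init T (p i) = s (i - 1)" "inp T (p i) = x i" "final T (p i) = s i"
      using p i by (auto simp: labelled_path_def)
    \<comment> \<open>Edges off the path contribute 0 even if their metric is infinite, since
      \<open>\<infinity> * 0 = 0\<close>.\<close>
    have "(\<Sum>e\<in>edges T. branch_metric P P0 T y i e * ereal (path_indicator N T p (i, e))) =
        (\<Sum>e\<in>edges T. if p i = e then branch_metric P P0 T y i e else 0)"
      by (rule sum.cong) (use i in \<open>auto simp: path_indicator_def\<close>)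
    also have "\<dots> = branch_metric P P0 T y i (p i)" using pi(1) by simp
    also have "\<dots> = neg_ln (?w i)" using pi by (auto simp: branch_metric_def)
    finally show ?thesis .
  qed
  then have "LP_cost N P P0 T y (path_indicator N T p) = (\<Sum>i=1..N. neg_ln (?w i))"
    by (simp add: LP_cost_def)
  also have "\<dots> = neg_ln (\<Prod>i=1..N. ?w i)"
    by (rule neg_ln_prod[symmetric]) (use nn in auto)
  also have "(\<Prod>i=1..N. ?w i) = path_likelihood N P P0 y (x, s)"
    using \<open>N > 0\<close> by (simp add: path_likelihood_def prod.distrib)
  finally show ?thesis .
qed

theorem theorem13:
  fixes M :: "'y measure"
    and P :: "'y \<Rightarrow> 's::finite \<Rightarrow> bit \<Rightarrow> 's \<Rightarrow> real"
    and P0 :: "'s pmf"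
    and T :: "'s trellis"
    and m N :: nat
    and H :: "nat \<Rightarrow> nat \<Rightarrow> bit"
    and y :: "nat \<Rightarrow> 'y"
    and g :: "nat \<times> nat \<Rightarrow> real"
  assumes "finite_state_channel M P"
    and "trellis_for_channel M P T"
    and "\<And>i. i \<in> {1..N} \<Longrightarrow> y i \<in> space M"
    and "is_arg_min (LP_cost N P P0 T y) (\<lambda>g. g \<in> trellis_relaxed_polytope m N H T) g"
    and "\<And>i e. i \<in> {1..N} \<Longrightarrow> e \<in> edges T \<Longrightarrow> g (i, e) \<in> {0, 1}"
  shows "\<exists>p x s. labelled_path N T p x s \<and> g = path_indicator N T p \<and>
           is_arg_max (path_likelihood N P P0 y) (\<lambda>v. v \<in> valid_pairs m N H T) (x, s)"
proof -
  have nn: "0 \<le> P (y i) s' x s" if "i \<in> {1..N}" for i s' x s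
    using assms(1) assms(3)[OF that] by (simp add: finite_state_channel_def)
  have g: "g \<in> trellis_relaxed_polytope m N H T"
    and opt: "\<And>h. h \<in> trellis_relaxed_polytope m N H T \<Longrightarrow>
      \<not> LP_cost N P P0 T y h < LP_cost N P P0 T y g"
    using assms(4) by (auto simp: is_arg_min_def)
  \<comment> \<open>For \<open>N = 0\<close> the LP does not see the initial state, so a most
    probable one is supplied; it exists because there are finitely many states.\<close>
  have "Max (range (pmf P0)) \<in> range (pmf P0)" by (rule Max_in) auto
  then obtain s0 where "Max (range (pmf P0)) = pmf P0 s0" by blast
  then have s0: "pmf P0 t \<le> pmf P0 s0" for t
    using Max_ge[of "range (pmf P0)" "pmf P0 t"] by simp
  have "g \<in> trellis_polytope N T" using g by (simp add: trellis_relaxed_polytope_def)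
  then obtain p x s where p: "labelled_path N T p x s" "g = path_indicator N T p"
    "N = 0 \<Longrightarrow> s 0 = s0"
    using integral_point_is_path_indicator[of g N T s0] assms(5) by metis
  have "(x, s) \<in> valid_pairs m N H T"
    using g p path_indicator_in_trellis_relaxed_polytope_iff by metis
  moreover have "\<not> path_likelihood N P P0 y (x, s) < path_likelihood N P P0 y v"
    if v: "v \<in> valid_pairs m N H T" for v
  proof (cases "N = 0")
    case True
    then show ?thesis using p(3) s0 by (simp add: path_likelihood_def split_beta not_less)
  next
    case False
    obtain x' s' p' where v': "v = (x', s')" "labelled_path N T p' x' s'"
      using v by (auto simp: valid_pairs_def)
    then have "path_indicator N T p' \<in> trellis_relaxed_polytope m N H T"
      using v path_indicator_in_trellis_relaxed_polytope_iff by metis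
    \<comment> \<open>The competitor's path is feasible for the LP, so a strictly larger likelihood
      would give a strictly smaller cost. This also covers an infinite minimum, where every valid
      pair has likelihood 0.\<close>
    then have "\<not> neg_ln (path_likelihood N P P0 y v) < neg_ln (path_likelihood N P P0 y (x, s))"
      using opt False p(1,2) v' nn LP_cost_path_indicator[where N = N and P = P and y = y]
      by (metis gr0I)
    then show ?thesis
      using neg_ln_less path_likelihood_nonneg[where N = N and P = P and y = y] nn by metis
  qed
  ultimately show ?thesis using p by (auto simp: is_arg_max_def)
qed

end
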